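(* Let $G = \langle X, (F(S))_{S\in[X]}\rangle$ be a contract choice problem. If $G$ satisfies the weak top coalition property, then $\mathrm{Core}(G) \neq \emptyset$.
   Context: Let $X$ be a non-empty finite subset of the natural numbers (the set of agents), and let $[X]$ denote the set of all non-empty subsets of $X$ (called coalitions). For $S\in[X]$, $\mathbb{R}^S$ is the set of real vectors indexed by $S$. A contract choice problem (CCP) is an ordered pair $G=\langle X,(F(S))_{S\in[X]}\rangle$ such that for all $S\in[X]$, $F(S)$ is a non-empty finite subset of $\mathbb{R}^S$, and $F(\{a\})=\{0\}$ for every $a\in X$. A coalition structure for $G$ is a partition of $X$ (into non-empty sets). A pay-off function is a function $v:X\to\mathbb{R}_+$ (non-negative reals); $v|S$ denotes its restriction to $S$. An outcome for $G$ is a pair $(f,v)$ where $f$ is a coalition structure for $G$ and $v$ is a pay-off function such that $v|S\in F(S)$ for all $S\in f$. A coalition $S\in[X]$ blocks an outcome $(f,v)$ if there exists $x\in F(S)$ with $x(a)>v(a)$ for all $a\in S$. $\mathrm{Core}(G)$ is the set of all outcomes for $G$ that do not admit any blocking coalition. Given a non-empty subset $V$ of $X$, an outcome $(f,v)$ has the weak top coalition property for $V$ if there exists a non-empty subset $S$ of $V$ which has a finite partition $\{S^1,\ldots,S^g\}$ (indexed in this order) such that: (a) $S\in f$; (b) for all $a\in S^1$: $v(a)\ge x(a)$ for all $T\subset V\setminus\{a\}$ (possibly empty) and all $x\in F(T\cup\{a\})$; (c) for all $t\in\{2,\ldots,g\}$, $a\in S^t$, $T\subset V\setminus\{a\}$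 and $x\in F(T\cup\{a\})$: $x(a)>v(a)$ implies $T\cap S^k\ne\emptyset$ for some $k<t$. $G$ satisfies the weak top coalition property if for every non-empty subset $V$ of $X$ there exists an outcome $(f,v)$ for $G$ having the weak top coalition property for $V$. *)

theory Defs
  imports Complex_Main "HOL-Library.FuncSet" "HOL-Library.Disjoint_Sets"
begin

definition coalitions :: "nat set \<Rightarrow> nat set set" where
  "coalitions X = {S. S \<subseteq> X \<and> S \<noteq> {}}"

text \<open>
  The space of real vectors indexed by \<open>S\<close> is the set \<open>S \<rightarrow>\<^sub>E UNIV\<close> of functions
  \<open>nat \<Rightarrow> real\<close> that are \<open>undefined\<close> outside \<open>S\<close>, so that equality of vectors is equality of
  functions and \<open>restrict v S\<close> is the restriction of \<open>v\<close> to \<open>S\<close>.  Only the values of \<open>F\<close> on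
  coalitions of \<open>X\<close> matter.
\<close>

definition ccp :: "nat set \<Rightarrow> (nat set \<Rightarrow> (nat \<Rightarrow> real) set) \<Rightarrow> bool" where
  "ccp X F \<longleftrightarrow>
     finite X \<and> X \<noteq> {} \<and>
     (\<forall>S\<in>coalitions X. F S \<subseteq> S \<rightarrow>\<^sub>E UNIV \<and> F S \<noteq> {} \<and> finite (F S)) \<and>
     (\<forall>a\<in>X. F {a} = {\<lambda>b\<in>{a}. 0})"

definition payoff_function :: "nat set \<Rightarrow> (nat \<Rightarrow> real) \<Rightarrow> bool" where
  "payoff_function X v \<longleftrightarrow> v \<in> X \<rightarrow>\<^sub>E {0..}"

definition outcome ::
  "nat set \<Rightarrow> (nat set \<Rightarrow> (nat \<Rightarrow> real) set) \<Rightarrow> nat set set \<times> (nat \<Rightarrow> real) \<Rightarrow> bool" where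
  "outcome X F = (\<lambda>(f, v).
     partition_on X f \<and> payoff_function X v \<and> (\<forall>S\<in>f. restrict v S \<in> F S))"

definition blocks ::
  "(nat set \<Rightarrow> (nat \<Rightarrow> real) set) \<Rightarrow> nat set \<Rightarrow> nat set set \<times> (nat \<Rightarrow> real) \<Rightarrow> bool" where
  "blocks F S = (\<lambda>(f, v). \<exists>x\<in>F S. \<forall>a\<in>S. x a > v a)"

definition Core ::
  "nat set \<Rightarrow> (nat set \<Rightarrow> (nat \<Rightarrow> real) set) \<Rightarrow> (nat set set \<times> (nat \<Rightarrow> real)) set" where
  "Core X F = {p. outcome X F p \<and> \<not> (\<exists>S\<in>coalitions X. blocks F S p)}"

text \<open>
  The ordered partition of \<open>S\<close> into \<open>g\<close> non-empty parts is given by \<open>P 1, \<dots>, P g\<close>; injectivity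
  makes parts with different indices different, hence disjoint.
\<close>

definition weak_top_coalition_for ::
  "(nat set \<Rightarrow> (nat \<Rightarrow> real) set) \<Rightarrow> nat set \<Rightarrow> nat set set \<times> (nat \<Rightarrow> real) \<Rightarrow> bool" where
  "weak_top_coalition_for F V = (\<lambda>(f, v).
     \<exists>S (g::nat) (P :: nat \<Rightarrow> nat set).
       S \<noteq> {} \<and> S \<subseteq> V \<and>
       partition_on S (P ` {1..g}) \<and> inj_on P {1..g} \<and>
       S \<in> f \<and>
       (\<forall>a\<in>P 1. \<forall>T. T \<subseteq> V - {a} \<longrightarrow> (\<forall>x\<in>F (T \<union> {a}). v a \<ge> x a)) \<and>
       (\<forall>t\<in>{2..g}. \<forall>a\<in>P t. \<forall>T. T \<subseteq> V - {a} \<longrightarrow>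
          (\<forall>x\<in>F (T \<union> {a}). x a > v a \<longrightarrow> (\<exists>k\<in>{1..<t}. T \<inter> P k \<noteq> {}))))"

definition weak_top_coalition_property ::
  "nat set \<Rightarrow> (nat set \<Rightarrow> (nat \<Rightarrow> real) set) \<Rightarrow> bool" where
  "weak_top_coalition_property X F \<longleftrightarrow>
     (\<forall>V. V \<noteq> {} \<and> V \<subseteq> X \<longrightarrow>
        (\<exists>p. outcome X F p \<and> weak_top_coalition_for F V p))"

end

theory Submission imports Defs begin

text \<open>
  Peel off top coalitions greedily: take a top coalition \<open>S\<close> of the remaining agents \<open>V\<close>, pay its
  members as prescribed, and continue with \<open>V - S\<close>.  A coalition inside \<open>V\<close> that meets \<open>S\<close> cannot
  block: among the parts of \<open>S\<close> that it meets, take the one of least index; a member in that part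
  cannot gain.  A coalition that does not meet \<open>S\<close> lies inside \<open>V - S\<close>.
\<close>

text \<open>This distils the ordered partition into the one fact that the recursion uses. The
  witness is sought in \<open>T \<inter> S\<close>, not just in \<open>T\<close>, so the conclusion
  depends on \<open>v\<close> only through its values on \<open>S\<close> and survives any change of
  payoffs elsewhere.\<close>

lemma weak_top_coalition_for_unblockable:
  assumes "weak_top_coalition_for F V (f, v)"
  obtains S where "S \<in> f" "S \<noteq> {}" "S \<subseteq> V"
    "\<And>T x. T \<subseteq> V \<Longrightarrow> T \<inter> S \<noteq> {} \<Longrightarrow> x \<in> F T \<Longrightarrow> \<exists>a\<in>T \<inter> S. x a \<le> v a"
proof -
  obtain S and g :: nat and P :: "nat \<Rightarrow> nat set" where
    S: "S \<noteq> {}" "S \<subseteq> V" "S \<in> f" and part: "partition_on S (P ` {1..g})"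
    and first: "\<forall>a\<in>P 1. \<forall>T. T \<subseteq> V - {a} \<longrightarrow> (\<forall>x\<in>F (T \<union> {a}). v a \<ge> x a)"
    and later: "\<forall>t\<in>{2..g}. \<forall>a\<in>P t. \<forall>T. T \<subseteq> V - {a} \<longrightarrow>
      (\<forall>x\<in>F (T \<union> {a}). x a > v a \<longrightarrow> (\<exists>k\<in>{1..<t}. T \<inter> P k \<noteq> {}))"
    using assms unfolding weak_top_coalition_for_def prod.case by (elim exE conjE) (rule that)
  have "\<exists>a\<in>T \<inter> S. x a \<le> v a" if T: "T \<subseteq> V" "T \<inter> S \<noteq> {}" and x: "x \<in> F T" for T x
  proof -
    define meets where "meets k \<longleftrightarrow> k \<in> {1..g} \<and> T \<inter> P k \<noteq> {}" for k
    have S_eq: "S = \<Union> (P ` {1..g})"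
      using part by (simp add: partition_on_def)
    with T have "\<exists>k. meets k"
      unfolding meets_def by blast
    then obtain k where k: "meets k" and least: "\<And>j. j < k \<Longrightarrow> \<not> meets j"
      using exists_least_iff[of meets] by meson
    from k obtain a where a: "a \<in> T" "a \<in> P k" and kg: "1 \<le> k" "k \<le> g"
      unfolding meets_def by auto
    \<comment> \<open>The hypotheses describe a coalition as \<open>a\<close> together with its
      partners; taking \<open>T - {a}\<close> as the set of partners recovers
      \<open>T\<close>.\<close>
    have T': "T - {a} \<subseteq> V - {a}" "T - {a} \<union> {a} = T"
      using T a by auto
    have "x a \<le> v a"
    proof (cases "k = 1")
      case True
      then have "\<forall>y\<in>F (T - {a} \<union> {a}). y a \<le> v a"
        using first a T'(1) by blast
      then show ?thesis
        using x unfolding T'(2) by blast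
    next
      case False
      then have "k \<in> {2..g}"
        using kg by auto
      then have "\<forall>y\<in>F (T - {a} \<union> {a}). y a > v a \<longrightarrow> (\<exists>j\<in>{1..<k}. (T - {a}) \<inter> P j \<noteq> {})"
        using later a T'(1) by blast
      then have "x a > v a \<longrightarrow> (\<exists>j\<in>{1..<k}. (T - {a}) \<inter> P j \<noteq> {})"
        using x unfolding T'(2) by blast
      \<comment> \<open>A gain for \<open>a\<close> would require a partner in an earlier part, but
        by minimality of \<open>k\<close> no earlier part meets \<open>T\<close>.\<close>
      moreover have "(T - {a}) \<inter> P j = {}" if "j \<in> {1..<k}" for j
        using least[of j] that kg unfolding meets_def by auto
      ultimately show ?thesis
        by (meson not_le)
    qed
    moreover have "a \<in> S"
      using a kg S_eq by auto
    ultimately show ?thesis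
      using a by blast
  qed
  with S(3,1,2) show thesis
    by (rule that)
qed

text \<open>Strong induction on \<open>V\<close> with \<open>X\<close> fixed: the outcome is
  relative to \<open>V\<close>, while the top coalitions come from outcomes for all of
  \<open>X\<close>.\<close>

lemma unblocked_outcome_on_subset:
  assumes "finite V" "V \<subseteq> X" and top: "weak_top_coalition_property X F"
  shows "\<exists>p. outcome V F p \<and> (\<forall>T\<in>coalitions V. \<not> blocks F T p)"
  using assms(1,2)
proof (induction V rule: finite_psubset_induct)
  case (psubset V)
  show ?case
  proof (cases "V = {}")
    case True
    \<comment> \<open>With no agents, an extensional payoff function has to be
      \<open>undefined\<close> everywhere.\<close>
    then have "outcome V F ({}, \<lambda>_. undefined)"
      by (simp add: outcome_def partition_on_def payoff_function_def)
    moreover have "coalitions V = {}"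
      using True by (auto simp: coalitions_def)
    ultimately show ?thesis
      by blast
  next
    case False
    then obtain f w where w: "outcome X F (f, w)" "weak_top_coalition_for F V (f, w)"
      using top psubset.prems unfolding weak_top_coalition_property_def by (metis surj_pair)
    obtain S where S: "S \<in> f" "S \<noteq> {}" "S \<subseteq> V"
      and unblockable:
        "\<And>T x. T \<subseteq> V \<Longrightarrow> T \<inter> S \<noteq> {} \<Longrightarrow> x \<in> F T \<Longrightarrow> \<exists>a\<in>T \<inter> S. x a \<le> w a"
      by (rule weak_top_coalition_for_unblockable[OF w(2)]) (rule that)
    have "V - S \<subset> V" "V - S \<subseteq> X"
      using S psubset.prems by auto
    from psubset.IH[OF this] obtain h u
      where u: "outcome (V - S) F (h, u)" "\<And>T. T \<in> coalitions (V - S) \<Longrightarrow> \<not> blocks F T (h, u)"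
      by auto
    \<comment> \<open>Outside \<open>V\<close> this is \<open>u\<close>, which is already
      \<open>undefined\<close> there, so \<open>v\<close> is extensional on
      \<open>V\<close>.\<close>
    define v where "v a = (if a \<in> S then w a else u a)" for a
    have "partition_on (V - S) h"
      using u(1) by (simp add: outcome_def)
    then have part: "partition_on V (insert S h)"
      using S by (subst partition_on_insert) (auto simp: partition_on_def disjnt_def)
    have "payoff_function V v"
      using u(1) w(1) S psubset.prems
      by (auto simp: payoff_function_def outcome_def v_def PiE_iff extensional_def)
    \<comment> \<open>No member of the new structure straddles \<open>S\<close> and
      \<open>V - S\<close>, so on each one \<open>v\<close> coincides with \<open>w\<close> or with
      \<open>u\<close>.\<close>
    moreover have "restrict v R \<in> F R" if "R \<in> insert S h" for R
    proof (cases "R = S")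
      case True
      then have "restrict v R = restrict w R"
        by (auto simp: v_def)
      then show ?thesis
        using w(1) S(1) True by (auto simp: outcome_def)
    next
      case False
      with that have "R \<in> h" by simp
      then have "R \<subseteq> V - S"
        using \<open>partition_on (V - S) h\<close> by (auto simp: partition_on_def)
      then have "restrict v R = restrict u R"
        by (intro restrict_ext) (auto simp: v_def)
      then show ?thesis
        using u(1) \<open>R \<in> h\<close> by (auto simp: outcome_def)
    qed
    ultimately have "outcome V F (insert S h, v)"
      using part by (simp add: outcome_def)
    moreover have "\<not> blocks F T (insert S h, v)" if T: "T \<in> coalitions V" for T
    proof
      assume "blocks F T (insert S h, v)"
      then obtain x where x: "x \<in> F T" "\<And>a. a \<in> T \<Longrightarrow> x a > v a"
        by (auto simp: blocks_def)
      show False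
      proof (cases "T \<inter> S = {}")
        case True
        then have "T \<in> coalitions (V - S)"
          using T by (auto simp: coalitions_def)
        moreover have "v a = u a" if "a \<in> T" for a
          using that True by (auto simp: v_def)
        then have "blocks F T (h, u)"
          using x by (auto simp: blocks_def)
        ultimately show False
          using u(2) by blast
      next
        \<comment> \<open>Some member of \<open>T\<close> in \<open>S\<close> gets at most
          \<open>w a\<close> from \<open>x\<close>, and \<open>v\<close> agrees with
          \<open>w\<close> on \<open>S\<close>.\<close>
        case False
        then obtain a where "a \<in> T \<inter> S" "x a \<le> w a"
          using unblockable[of T x] T x(1) by (auto simp: coalitions_def)
        then show False
          using x(2)[of a] by (simp add: v_def)
      qed
    qed
    ultimately show ?thesis
      by blast
  qed
qed

theorem theorem1:
  fixes X :: "nat set" and F :: "nat set \<Rightarrow> (nat \<Rightarrow> real) set"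
  assumes "ccp X F"
    and "weak_top_coalition_property X F"
  shows "Core X F \<noteq> {}"
proof -
  have "finite X"
    using assms(1) by (simp add: ccp_def)
  then show ?thesis
    using unblocked_outcome_on_subset[OF _ subset_refl assms(2)] by (auto simp: Core_def)
qed

end
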